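(* Let $X$ be a real Hilbert space, let $R\colon X\to X$ be linear and nonexpansive (i.e., $\|Rx-Ry\|\le\|x-y\|$ for all $x,y\in X$), set $D:=\operatorname{Fix}R=\ker(\mathrm{Id}-R)$, and suppose that $\operatorname{ran}(\mathrm{Id}-R)$ is closed. Set $$T:=P_{D^\perp}(\mathrm{Id}-R)^{-1}P_{D^\perp}-\tfrac12P_{D^\perp}.$$ Then the following hold: (i) The set-valued inverse of $\mathrm{Id}-R$ is $$(\mathrm{Id}-R)^{-1}=\tfrac12\mathrm{Id}+T+N_{D^\perp}.$$ (ii) The Moore–Penrose inverse of $\mathrm{Id}-R$ is $$(\mathrm{Id}-R)^\dagger=T+\tfrac12P_{D^\perp}.$$
   Context: $\mathrm{Id}$ is the identity on $X$; $P_C$ is the orthogonal projection onto a closed linear subspace $C$; $(\mathrm{Id}-R)^{-1}\colon X\rightrightarrows X$ is the set-valued inverse, $(\mathrm{Id}-R)^{-1}y=\{x\in X: x-Rx=y\}$. Compositions and sums are those of set-valued operators, so $P_{D^\perp}(\mathrm{Id}-R)^{-1}P_{D^\perp}z=\{P_{D^\perp}x: x-Rx=P_{D^\perp}z\}$; when $\operatorname{ran}(\mathrm{Id}-R)$ is closed it equals $D^\perp$ and $T$ is single-valued, so $T$ is regarded as a map $X\to X$. $N_{D^\perp}$ is the normal cone operator of the closed subspace $D^\perp$: $N_{D^\perp}y=D$ if $y\in D^\perp$ and $N_{D^\perp}y=\varnothing$ otherwise. The Moore–Penrose inverse $L^\dagger$ of a bounded linear operator $L$ with closed range maps $y\in X$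 to the element of minimal norm in $\{x\in X: Lx=P_{\operatorname{ran}L}y\}$. *)

theory Defs
  imports "HOL-Analysis.Analysis"
begin

section \<open>Set-valued operators\<close>

text \<open>A set-valued operator on \<open>X\<close> is a function of type \<^typ>\<open>'a \<Rightarrow> 'a set\<close>.  Sums and
  differences are spelled out elementwise, since \<open>-\<close> on sets is set difference.\<close>

definition single :: "('a \<Rightarrow> 'b) \<Rightarrow> 'a \<Rightarrow> 'b set"
  where "single f = (\<lambda>x. {f x})"

definition sv_inverse :: "('a \<Rightarrow> 'b set) \<Rightarrow> 'b \<Rightarrow> 'a set"
  where "sv_inverse A = (\<lambda>y. {x. y \<in> A x})"

definition sv_comp :: "('b \<Rightarrow> 'c set) \<Rightarrow> ('a \<Rightarrow> 'b set) \<Rightarrow> 'a \<Rightarrow> 'c set"  (infixr \<open>\<circ>\<^sub>s\<close> 75)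
  where "A \<circ>\<^sub>s B = (\<lambda>x. \<Union>y\<in>B x. A y)"

definition sv_add :: "('a \<Rightarrow> 'b::plus set) \<Rightarrow> ('a \<Rightarrow> 'b set) \<Rightarrow> 'a \<Rightarrow> 'b set"  (infixl \<open>\<oplus>\<^sub>s\<close> 65)
  where "A \<oplus>\<^sub>s B = (\<lambda>x. {u + v |u v. u \<in> A x \<and> v \<in> B x})"

definition sv_diff :: "('a \<Rightarrow> 'b::minus set) \<Rightarrow> ('a \<Rightarrow> 'b set) \<Rightarrow> 'a \<Rightarrow> 'b set"  (infixl \<open>\<ominus>\<^sub>s\<close> 65)
  where "A \<ominus>\<^sub>s B = (\<lambda>x. {u - v |u v. u \<in> A x \<and> v \<in> B x})"

definition normal_cone :: "'a::real_inner set \<Rightarrow> 'a \<Rightarrow> 'a set"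
  where "normal_cone C = (\<lambda>x. if x \<in> C then {u. \<forall>c\<in>C. inner u (c - x) \<le> 0} else {})"


section \<open>Orthogonal projection and Moore--Penrose inverse\<close>

text \<open>The descriptions below are meaningful when \<open>C\<close> is a closed subspace of a Hilbert space, and
  when \<open>L\<close> is bounded linear with closed range; see \<open>proj_ex1\<close> and \<open>mp_inverse_ex1\<close>.\<close>

definition proj :: "'a::real_inner set \<Rightarrow> 'a \<Rightarrow> 'a"
  where "proj C x = (THE p. p \<in> C \<and> x - p \<in> C\<^sup>\<bottom>)"

definition mp_inverse :: "('a::real_normed_vector \<Rightarrow> 'b::real_inner) \<Rightarrow> 'b \<Rightarrow> 'a"
  where "mp_inverse L y =
    (THE x. L x = proj (range L) y \<and> (\<forall>x'. L x' = proj (range L) y \<longrightarrow> norm x \<le> norm x'))"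


section \<open>The operator \<open>T\<close>\<close>

definition Fix :: "('a \<Rightarrow> 'a) \<Rightarrow> 'a set"
  where "Fix R = {x. R x = x}"

definition T_sv :: "('a::real_inner \<Rightarrow> 'a) \<Rightarrow> 'a \<Rightarrow> 'a set"
  where "T_sv R =
    (single (proj ((Fix R)\<^sup>\<bottom>)) \<circ>\<^sub>s sv_inverse (single (\<lambda>x. x - R x)) \<circ>\<^sub>s single (proj ((Fix R)\<^sup>\<bottom>)))
    \<ominus>\<^sub>s single (\<lambda>z. (1/2) *\<^sub>R proj ((Fix R)\<^sup>\<bottom>) z)"

text \<open>\<open>T\<close> as a map, which is sensible only where \<^const>\<open>T_sv\<close> has singleton values.\<close>

definition T_map :: "('a::real_inner \<Rightarrow> 'a) \<Rightarrow> 'a \<Rightarrow> 'a"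
  where "T_map R z = the_elem (T_sv R z)"


section \<open>The descriptions are well defined\<close>

lemma proj_unique:
  fixes C :: "'a::real_inner set"
  assumes "subspace C" "p \<in> C" "x - p \<in> C\<^sup>\<bottom>" "q \<in> C" "x - q \<in> C\<^sup>\<bottom>"
  shows "p = q"
proof -
  have "p - q \<in> C" using assms by (simp add: subspace_diff)
  then have "inner (p - q) (x - q) = 0" "inner (p - q) (x - p) = 0"
    using assms by (auto simp: orthogonal_comp_def orthogonal_def)
  then have "inner (p - q) (p - q) = 0"
    by (simp add: inner_diff_right)
  then show ?thesis by simp
qed

lemma parallelogram:
  fixes a b :: "'a::real_inner"
  shows "(norm (a - b))\<^sup>2 = 2 * (norm a)\<^sup>2 + 2 * (norm b)\<^sup>2 - (norm (a + b))\<^sup>2"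
  by (simp add: power2_norm_eq_inner inner_diff_left inner_diff_right inner_add_left
      inner_add_right inner_commute)

lemma proj_exists:
  fixes C :: "'a::{real_inner,complete_space} set"
  assumes sub: "subspace C" and cl: "closed C"
  shows "\<exists>p. p \<in> C \<and> x - p \<in> C\<^sup>\<bottom>"
proof -
  define d where "d = (INF c\<in>C. (norm (x - c))\<^sup>2)"
  have ne: "C \<noteq> {}" using sub subspace_0 by blast
  have bdd: "bdd_below ((\<lambda>c. (norm (x - c))\<^sup>2) ` C)" by (rule bdd_belowI2[of _ 0]) simp
  have dle: "d \<le> (norm (x - c))\<^sup>2" if "c \<in> C" for c
    unfolding d_def using bdd that by (rule cINF_lower)
  have "\<exists>c\<in>C. (norm (x - c))\<^sup>2 < d + inverse (real (Suc n))" for n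
  proof -
    have "d < d + inverse (real (Suc n))" by simp
    then show ?thesis using cINF_less_iff[OF ne bdd] unfolding d_def by blast
  qed
  then obtain s where sC: "\<And>n. s n \<in> C"
    and s: "\<And>n. (norm (x - s n))\<^sup>2 < d + inverse (real (Suc n))" by metis
  have key: "(norm (s m - s n))\<^sup>2 \<le> 2 * inverse (real (Suc m)) + 2 * inverse (real (Suc n))" for m n
  proof -
    have "(1/2) *\<^sub>R (s m + s n) \<in> C" using sub sC by (simp add: subspace_add subspace_scale)
    then have "d \<le> (norm (x - (1/2) *\<^sub>R (s m + s n)))\<^sup>2" by (rule dle)
    moreover have "(x - s n) + (x - s m) = 2 *\<^sub>R (x - (1/2) *\<^sub>R (s m + s n))"
      by (simp add: algebra_simps scaleR_2)
    then have "(norm ((x - s n) + (x - s m)))\<^sup>2 = 4 * (norm (x - (1/2) *\<^sub>R (s m + s n)))\<^sup>2"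
      by (simp add: power_mult_distrib)
    ultimately show ?thesis
      using parallelogram[of "x - s n" "x - s m"] s[of m] s[of n] by simp
  qed
  have "Cauchy s"
  proof (rule metric_CauchyI)
    fix e :: real assume e: "0 < e"
    then obtain N where N: "inverse (real (Suc N)) < e\<^sup>2 / 4"
      using reals_Archimedean[of "e\<^sup>2 / 4"] by auto
    have "dist (s m) (s n) < e" if "m \<ge> N" "n \<ge> N" for m n
    proof -
      have "inverse (real (Suc m)) \<le> inverse (real (Suc N))"
        "inverse (real (Suc n)) \<le> inverse (real (Suc N))"
        using that by (simp_all add: le_imp_inverse_le)
      then have "(norm (s m - s n))\<^sup>2 < e\<^sup>2" using key[of m n] N by linarith
      then show ?thesis using e by (simp add: dist_norm power2_less_imp_less)
    qed
    then show "\<exists>N. \<forall>m\<ge>N. \<forall>n\<ge>N. dist (s m) (s n) < e" by blast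
  qed
  then obtain p where p: "s \<longlonglongrightarrow> p" using Cauchy_convergent convergent_def by blast
  have pC: "p \<in> C" using cl sC p closed_sequentially by blast
  have "(\<lambda>n. (norm (x - s n))\<^sup>2) \<longlonglongrightarrow> (norm (x - p))\<^sup>2" by (intro tendsto_intros p)
  moreover have "(\<lambda>n. d + inverse (real (Suc n))) \<longlonglongrightarrow> d + 0"
    by (intro tendsto_intros LIMSEQ_inverse_real_of_nat)
  ultimately have pd: "(norm (x - p))\<^sup>2 \<le> d"
    using s by (intro LIMSEQ_le[where Y = "\<lambda>n. d + inverse (real (Suc n))"]) (auto intro: less_imp_le)
  have "inner c (x - p) = 0" if c: "c \<in> C" for c
  proof (cases "c = 0")
    case False
    define t where "t = inner c (x - p) / inner c c"
    have "p + t *\<^sub>R c \<in> C" using sub pC c by (simp add: subspace_add subspace_scale)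
    then have "(norm (x - p))\<^sup>2 \<le> (norm ((x - p) - t *\<^sub>R c))\<^sup>2"
      using pd dle[of "p + t *\<^sub>R c"] unfolding diff_diff_eq by linarith
    also have "\<dots> = (norm (x - p))\<^sup>2 - 2 * t * inner c (x - p) + t * t * inner c c"
      by (simp add: power2_norm_eq_inner inner_diff_left inner_diff_right inner_commute algebra_simps)
    also have "t * t * inner c c = t * inner c (x - p)" using False by (simp add: t_def)
    finally have "t * inner c (x - p) \<le> 0" by simp
    then have "(inner c (x - p))\<^sup>2 / inner c c \<le> 0" by (simp add: t_def power2_eq_square)
    moreover have "inner c c > 0" using False by simp
    ultimately have "(inner c (x - p))\<^sup>2 \<le> 0" by (simp add: divide_le_0_iff)
    then show ?thesis by simp
  qed simp
  with pC show ?thesis by (auto simp: orthogonal_comp_def orthogonal_def)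
qed

lemma proj_ex1:
  fixes C :: "'a::{real_inner,complete_space} set"
  assumes "subspace C" "closed C"
  shows "\<exists>!p. p \<in> C \<and> x - p \<in> C\<^sup>\<bottom>"
  using proj_exists[OF assms] proj_unique[OF assms(1)] by blast

lemma orthogonal_comp_twice:
  fixes C :: "'a::{real_inner,complete_space} set"
  assumes "subspace C" "closed C"
  shows "C\<^sup>\<bottom>\<^sup>\<bottom> = C"
proof
  show "C \<subseteq> C\<^sup>\<bottom>\<^sup>\<bottom>" by (auto simp: orthogonal_comp_def orthogonal_commute)
  show "C\<^sup>\<bottom>\<^sup>\<bottom> \<subseteq> C"
  proof
    fix x assume x: "x \<in> C\<^sup>\<bottom>\<^sup>\<bottom>"
    obtain p where p: "p \<in> C" "x - p \<in> C\<^sup>\<bottom>" using proj_exists[OF assms] by blast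
    have "inner (x - p) x = 0"
      using x p(2) unfolding orthogonal_comp_def[of "C\<^sup>\<bottom>"] orthogonal_def by blast
    moreover have "inner (x - p) p = 0"
      using p by (auto simp: orthogonal_comp_def orthogonal_def inner_commute)
    ultimately have "inner (x - p) (x - p) = 0" by (simp add: inner_diff_right)
    then show "x \<in> C" using p by simp
  qed
qed

lemma normal_cone_subspace:
  fixes C :: "'a::real_inner set"
  assumes "subspace C"
  shows "normal_cone C x = (if x \<in> C then C\<^sup>\<bottom> else {})"
proof -
  have "(\<forall>c\<in>C. inner u (c - x) \<le> 0) \<longleftrightarrow> u \<in> C\<^sup>\<bottom>" if x: "x \<in> C" for u
  proof
    assume h: "\<forall>c\<in>C. inner u (c - x) \<le> 0"
    have "inner c u = 0" if "c \<in> C" for c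
    proof -
      have "x + c \<in> C" "x - c \<in> C" using assms x that by (auto intro: subspace_add subspace_diff)
      then have "inner u (x + c - x) \<le> 0" "inner u (x - c - x) \<le> 0" using h by blast+
      then show ?thesis by (simp add: inner_commute)
    qed
    then show "u \<in> C\<^sup>\<bottom>" by (auto simp: orthogonal_comp_def orthogonal_def)
  next
    assume "u \<in> C\<^sup>\<bottom>"
    then have "inner u (c - x) = 0" if "c \<in> C" for c
      using subspace_diff[OF assms that x]
      by (simp add: orthogonal_comp_def orthogonal_def inner_commute[of u])
    then show "\<forall>c\<in>C. inner u (c - x) \<le> 0" by simp
  qed
  then show ?thesis by (auto simp: normal_cone_def)
qed

lemma normal_cone_orthogonal_comp:
  fixes D :: "'a::{real_inner,complete_space} set"
  assumes "subspace D" "closed D"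
  shows "normal_cone (D\<^sup>\<bottom>) y = (if y \<in> D\<^sup>\<bottom> then D else {})"
  using normal_cone_subspace[OF subspace_orthogonal_comp] orthogonal_comp_twice[OF assms] by metis

lemma mp_inverse_ex1:
  fixes L :: "'a::{real_inner,complete_space} \<Rightarrow> 'b::{real_inner,complete_space}"
  assumes "bounded_linear L" "closed (range L)"
  shows "\<exists>!x. L x = proj (range L) y \<and> (\<forall>x'. L x' = proj (range L) y \<longrightarrow> norm x \<le> norm x')"
proof -
  interpret bounded_linear L by fact
  have lin: "linear L" by (rule linear_axioms)
  define K where "K = {x. L x = 0}"
  have K: "subspace K" unfolding K_def using lin by (rule linear_subspace_kernel)
  have clK: "closed K"
    unfolding K_def by (intro closed_Collect_eq continuous_intros continuous_on)
  have "proj (range L) y \<in> range L"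
    using theI'[OF proj_ex1[OF _ assms(2)]] linear_subspace_image[OF lin subspace_UNIV]
    unfolding proj_def by blast
  then obtain x0 where x0: "L x0 = proj (range L) y" by auto
  obtain k where k: "k \<in> K" "x0 - k \<in> K\<^sup>\<bottom>" using proj_exists[OF K clK] by blast
  define p where "p = x0 - k"
  have Lp: "L p = proj (range L) y" using x0 k by (simp add: p_def diff K_def)
  have pyth: "(norm x)\<^sup>2 = (norm p)\<^sup>2 + (norm (x - p))\<^sup>2" if "L x = proj (range L) y" for x
  proof -
    have "x - p \<in> K" using that Lp by (simp add: K_def diff)
    then have "inner (x - p) p = 0" using k by (auto simp: p_def orthogonal_comp_def orthogonal_def)
    then show ?thesis
      by (simp add: power2_norm_eq_inner inner_diff_left inner_diff_right inner_commute)
  qed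
  show ?thesis
  proof (rule ex1I[of _ p])
    have "norm p \<le> norm x" if "L x = proj (range L) y" for x
      by (rule power2_le_imp_le) (use pyth[OF that] in auto)
    then show "L p = proj (range L) y \<and> (\<forall>x'. L x' = proj (range L) y \<longrightarrow> norm p \<le> norm x')"
      using Lp by blast
  next
    fix x assume x: "L x = proj (range L) y \<and> (\<forall>x'. L x' = proj (range L) y \<longrightarrow> norm x \<le> norm x')"
    then have "norm x \<le> norm p" using Lp by blast
    then have "(norm x)\<^sup>2 \<le> (norm p)\<^sup>2" by (rule power_mono) simp
    then have "(norm (x - p))\<^sup>2 \<le> 0" using pyth[of x] x by linarith
    then show "x = p" by simp
  qed
qed

end

theory Submission
  imports Defs
begin

text \<open>For a nonexpansive linear \<open>R\<close> one has \<open>(ran (Id - R))\<^sup>\<bottom> = Fix R\<close>, so a closed range equals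
  \<open>(Fix R)\<^sup>\<bottom>\<close>.  Hence \<open>x - R x = P z\<close>, with \<open>P\<close> the projection onto \<open>(Fix R)\<^sup>\<bottom>\<close>, has exactly one
  solution \<open>p \<in> (Fix R)\<^sup>\<bottom>\<close>; its solution set is \<open>p + Fix R\<close>, whose element of minimal norm is \<open>p\<close>,
  and \<open>T z = p - P z / 2\<close>.\<close>

lemma proj_eqI:
  assumes "subspace C" "p \<in> C" "x - p \<in> C\<^sup>\<bottom>"
  shows "proj C x = p"
  unfolding proj_def using assms proj_unique[OF assms(1)] by (intro the_equality) auto

lemma Fix_eq_kernel: "Fix R = {x. x - R x = (0::'a::real_vector)}"
  by (auto simp: Fix_def)

lemma linear_id_minus:
  assumes "linear R"
  shows "linear (\<lambda>x. x - R x)"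
  using linear_compose_sub[OF linear_id assms] by (simp add: id_def)

lemma subspace_Fix:
  assumes "linear R"
  shows "subspace (Fix R)"
  unfolding Fix_eq_kernel using linear_id_minus[OF assms] by (rule linear_subspace_kernel)

text \<open>For linear \<open>R\<close>, \<open>contr\<close> is nonexpansiveness tested against the
  origin; linearity recovers it for all differences.\<close>

locale linear_contraction =
  fixes R :: "'a::real_inner \<Rightarrow> 'a"
  assumes lin: "linear R"
    and contr: "norm (R x) \<le> norm x"
begin

lemma bounded: "bounded_linear (\<lambda>x. x - R x)"
  using contr by (intro bounded_linear_sub bounded_linear_ident bounded_linear_intro[of R 1])
    (simp_all add: linear_add[OF lin] linear_scale[OF lin])

lemma closed_Fix: "closed (Fix R)"
  unfolding Fix_eq_kernel
  by (intro closed_Collect_eq linear_continuous_on[OF bounded] continuous_intros)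

lemma inner_contraction: "inner (R x) (R x) \<le> inner x x"
  using power_mono[OF contr[of x], of 2] by (simp add: power2_norm_eq_inner)

text \<open>Apply the contraction bound to \<open>d + t *\<^sub>R x\<close>. Since
  \<open>R d = d\<close>, the squared norms of \<open>d\<close> cancel, leaving a quadratic in
  \<open>t\<close> that is nonnegative and vanishes at 0, so its linear coefficient
  \<open>2 * a\<close> must be 0.\<close>

lemma Fix_orthogonal_range:
  assumes "d \<in> Fix R"
  shows "inner d (x - R x) = 0"
proof (rule ccontr)
  define a where "a = inner d (x - R x)"
  define b where "b = inner x x - inner (R x) (R x)"
  assume "inner d (x - R x) \<noteq> 0"
  then have a: "a \<noteq> 0" by (simp add: a_def)
  have b: "b \<ge> 0" using inner_contraction by (simp add: b_def)
  have Rd: "R d = d" using assms by (simp add: Fix_def)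
  have nonneg: "0 \<le> 2 * t * a + t * t * b" for t
    using inner_contraction[of "d + t *\<^sub>R x"]
    by (simp add: linear_add[OF lin] linear_scale[OF lin] Rd a_def b_def inner_add_left
        inner_add_right inner_diff_right inner_commute algebra_simps)
  \<comment> \<open>The quadratic is smallest at \<open>- a / b\<close>; using \<open>b + 1\<close>
    instead avoids dividing by zero and still gives a negative value.\<close>
  define s where "s = a / (b + 1)"
  have s: "a = s * (b + 1)" "s \<noteq> 0" using a b by (auto simp: s_def)
  have "0 \<le> 2 * (- s) * a + (- s) * (- s) * b" by (rule nonneg)
  also have "\<dots> = - (s * s * (b + 2))" using s(1) by (simp add: algebra_simps)
  also have "\<dots> < 0" using s(2) b by (auto simp: zero_less_mult_iff linorder_neq_iff)
  finally show False by simp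
qed

text \<open>For the harder inclusion, test \<open>u\<close> only against \<open>u - R u\<close>:
  then \<open>u - R u\<close> has squared norm equal to that of \<open>R u\<close> minus that of
  \<open>u\<close>, hence at most 0.\<close>

lemma orthogonal_comp_range: "(range (\<lambda>x. x - R x))\<^sup>\<bottom> = Fix R"
proof
  show "Fix R \<subseteq> (range (\<lambda>x. x - R x))\<^sup>\<bottom>"
    using Fix_orthogonal_range by (auto simp: orthogonal_comp_def orthogonal_def inner_commute)
  show "(range (\<lambda>x. x - R x))\<^sup>\<bottom> \<subseteq> Fix R"
  proof
    fix u assume "u \<in> (range (\<lambda>x. x - R x))\<^sup>\<bottom>"
    then have "inner (u - R u) u = 0" by (auto simp: orthogonal_comp_def orthogonal_def)
    then have "inner (u - R u) (u - R u) = inner (R u) (R u) - inner u u"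
      by (simp add: inner_diff_left inner_diff_right inner_commute)
    also have "\<dots> \<le> 0" using inner_contraction by simp
    finally show "u \<in> Fix R"
      by (simp add: Fix_eq_kernel flip: power2_norm_eq_inner)
  qed
qed

lemma solution_iff:
  assumes "p - R p = y"
  shows "x - R x = y \<longleftrightarrow> x - p \<in> Fix R"
proof -
  have "(x - p) - R (x - p) = (x - R x) - y"
    unfolding assms[symmetric] by (simp add: linear_diff[OF lin])
  then show ?thesis by (metis (mono_tags) Fix_eq_kernel mem_Collect_eq right_minus_eq)
qed

end

locale closed_range_contraction = linear_contraction R
  for R :: "'a::{real_inner,complete_space} \<Rightarrow> 'a" +
  assumes cl: "closed (range (\<lambda>x. x - R x))"
begin

text \<open>Take complements in \<open>orthogonal_comp_range\<close>: a closed subspace is its own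
  double complement.\<close>

lemma range_eq: "range (\<lambda>x. x - R x) = (Fix R)\<^sup>\<bottom>"
  using orthogonal_comp_twice[OF linear_subspace_image[OF linear_id_minus[OF lin] subspace_UNIV] cl]
  by (simp add: orthogonal_comp_range)

lemma comp_comp: "(Fix R)\<^sup>\<bottom>\<^sup>\<bottom> = Fix R"
  by (rule orthogonal_comp_twice[OF subspace_Fix[OF lin] closed_Fix])

lemma proj_eq: "proj ((Fix R)\<^sup>\<bottom>) x = p" if "p \<in> (Fix R)\<^sup>\<bottom>" "x - p \<in> Fix R"
  using that by (intro proj_eqI subspace_orthogonal_comp) (simp_all add: comp_comp)

lemma proj_in: "proj ((Fix R)\<^sup>\<bottom>) x \<in> (Fix R)\<^sup>\<bottom>"
  using theI'[OF proj_ex1[OF subspace_orthogonal_comp[of "Fix R"]]] cl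
  unfolding proj_def range_eq by blast

text \<open>Removing the \<open>Fix R\<close> component of any solution leaves
  \<open>x - R x\<close> unchanged, because \<open>Fix R\<close> is the kernel.\<close>

lemma solution_exists:
  obtains p where "p \<in> (Fix R)\<^sup>\<bottom>" "p - R p = proj ((Fix R)\<^sup>\<bottom>) z"
proof -
  obtain x where x: "x - R x = proj ((Fix R)\<^sup>\<bottom>) z"
    using proj_in[of z] unfolding range_eq[symmetric] by (metis imageE)
  obtain d where d: "d \<in> Fix R" "x - d \<in> (Fix R)\<^sup>\<bottom>"
    using proj_exists[OF subspace_Fix[OF lin] closed_Fix] by blast
  have "(x - d) - R (x - d) = proj ((Fix R)\<^sup>\<bottom>) z"
    using x d(1) by (simp add: linear_diff[OF lin] Fix_def)
  with d(2) show ?thesis by (rule that)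
qed

text \<open>All solutions lie in the coset of \<open>p\<close> modulo \<open>Fix R\<close>, which
  the projection collapses to \<open>p\<close>.\<close>

lemma T_sv_eq:
  assumes p: "p \<in> (Fix R)\<^sup>\<bottom>" "p - R p = proj ((Fix R)\<^sup>\<bottom>) z"
  shows "T_sv R z = {p - (1/2) *\<^sub>R proj ((Fix R)\<^sup>\<bottom>) z}"
proof -
  have "proj ((Fix R)\<^sup>\<bottom>) x = p" if "x - R x = proj ((Fix R)\<^sup>\<bottom>) z" for x
    using that p(1) by (simp add: solution_iff[OF p(2)] proj_eq)
  then have "proj ((Fix R)\<^sup>\<bottom>) ` {x. x - R x = proj ((Fix R)\<^sup>\<bottom>) z} =
      (\<lambda>_. p) ` {x. x - R x = proj ((Fix R)\<^sup>\<bottom>) z}"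
    by (intro image_cong) auto
  \<comment> \<open>The constant image is a singleton because the solution set contains
    \<open>p\<close>.\<close>
  also have "\<dots> = {p}" using p(2) by (intro image_constant[where x = p]) simp
  finally have "proj ((Fix R)\<^sup>\<bottom>) ` {x. x - R x = proj ((Fix R)\<^sup>\<bottom>) z} = {p}" .
  moreover have "T_sv R z = (\<lambda>u. u - (1/2) *\<^sub>R proj ((Fix R)\<^sup>\<bottom>) z) `
      proj ((Fix R)\<^sup>\<bottom>) ` {x. x - R x = proj ((Fix R)\<^sup>\<bottom>) z}"
    by (auto simp: T_sv_def sv_diff_def sv_comp_def sv_inverse_def single_def) metis
  ultimately show ?thesis by simp
qed

lemma T_map_eq:
  assumes "p \<in> (Fix R)\<^sup>\<bottom>" "p - R p = proj ((Fix R)\<^sup>\<bottom>) z"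
  shows "T_map R z = p - (1/2) *\<^sub>R proj ((Fix R)\<^sup>\<bottom>) z"
  using T_sv_eq[OF assms] by (simp add: T_map_def)

lemma T_sv_single: "T_sv R z = {T_map R z}"
  using solution_exists[of z] T_sv_eq T_map_eq by metis

text \<open>Off \<open>(Fix R)\<^sup>\<bottom>\<close> both sides are empty. On it the projection
  fixes \<open>y\<close>, so the halves cancel to leave \<open>p\<close>, and the normal cone
  contributes \<open>Fix R\<close>, giving the full solution coset.\<close>

lemma sv_inverse_id_minus:
  "sv_inverse (single (\<lambda>x. x - R x)) =
    single (\<lambda>x. (1/2) *\<^sub>R x) \<oplus>\<^sub>s single (T_map R) \<oplus>\<^sub>s normal_cone ((Fix R)\<^sup>\<bottom>)"
proof
  fix y
  have rhs: "(single (\<lambda>x. (1/2) *\<^sub>R x) \<oplus>\<^sub>s single (T_map R) \<oplus>\<^sub>s normal_cone ((Fix R)\<^sup>\<bottom>)) y =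
      (if y \<in> (Fix R)\<^sup>\<bottom> then {x. x - ((1/2) *\<^sub>R y + T_map R y) \<in> Fix R} else {})"
    by (force simp: sv_add_def single_def
        normal_cone_orthogonal_comp[OF subspace_Fix[OF lin] closed_Fix])
  show "sv_inverse (single (\<lambda>x. x - R x)) y =
      (single (\<lambda>x. (1/2) *\<^sub>R x) \<oplus>\<^sub>s single (T_map R) \<oplus>\<^sub>s normal_cone ((Fix R)\<^sup>\<bottom>)) y"
  proof (cases "y \<in> (Fix R)\<^sup>\<bottom>")
    case True
    then have y: "proj ((Fix R)\<^sup>\<bottom>) y = y"
      by (rule proj_eq) (simp add: subspace_0 subspace_Fix[OF lin])
    obtain p where p: "p \<in> (Fix R)\<^sup>\<bottom>" "p - R p = proj ((Fix R)\<^sup>\<bottom>) y"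
      by (rule solution_exists)
    have "(1/2) *\<^sub>R y + T_map R y = p" using T_map_eq[OF p] y by simp
    then show ?thesis
      using solution_iff[OF p(2)] y True unfolding rhs
      by (simp add: sv_inverse_def single_def eq_commute[of y])
  next
    case False
    then show ?thesis
      unfolding rhs by (auto simp: sv_inverse_def single_def range_eq[symmetric])
  qed
qed

text \<open>Any solution differs from \<open>p\<close> by an element of \<open>Fix R\<close>, which
  is orthogonal to \<open>p\<close>; by Pythagoras \<open>p\<close> has minimal norm.\<close>

lemma mp_inverse_id_minus:
  "mp_inverse (\<lambda>x. x - R x) y = T_map R y + (1/2) *\<^sub>R proj ((Fix R)\<^sup>\<bottom>) y"
proof -
  obtain p where p: "p \<in> (Fix R)\<^sup>\<bottom>" "p - R p = proj ((Fix R)\<^sup>\<bottom>) y"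
    by (rule solution_exists)
  have "norm p \<le> norm x" if "x - R x = proj ((Fix R)\<^sup>\<bottom>) y" for x
  proof -
    have "inner (x - p) p = 0"
      using that p(1) solution_iff[OF p(2)] by (auto simp: orthogonal_comp_def orthogonal_def)
    then have "(norm x)\<^sup>2 = (norm p)\<^sup>2 + (norm (x - p))\<^sup>2"
      by (simp add: power2_norm_eq_inner inner_diff_left inner_diff_right inner_commute)
    then show ?thesis by (simp add: power2_le_imp_le[OF _ norm_ge_zero])
  qed
  then have "mp_inverse (\<lambda>x. x - R x) y = p"
    unfolding mp_inverse_def using p(2)
    by (intro the1_equality[OF mp_inverse_ex1[OF bounded cl]]) (auto simp: range_eq)
  then show ?thesis by (simp add: T_map_eq[OF p])
qed

end

text \<open>The first conjunct justifies treating \<open>T\<close> as a map: \<open>the_elem\<close>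
  is meaningful only on singletons.\<close>

theorem theorem2p8:
  fixes R :: "'a::{real_inner,complete_space} \<Rightarrow> 'a"
  assumes "linear R"
    and "\<forall>x y. norm (R x - R y) \<le> norm (x - y)"
    and "closed (range (\<lambda>x. x - R x))"
  shows "(\<forall>z. T_sv R z = {T_map R z}) \<and>
    sv_inverse (single (\<lambda>x. x - R x)) =
      single (\<lambda>x. (1/2) *\<^sub>R x) \<oplus>\<^sub>s single (T_map R) \<oplus>\<^sub>s normal_cone ((Fix R)\<^sup>\<bottom>) \<and>
    mp_inverse (\<lambda>x. x - R x) = (\<lambda>y. T_map R y + (1/2) *\<^sub>R proj ((Fix R)\<^sup>\<bottom>) y)"
proof -
  have "norm (R x) \<le> norm x" for x
    using assms(2)[rule_format, of x 0] by (simp add: linear_0[OF assms(1)])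
  then interpret closed_range_contraction R
    using assms(1,3)
    by (intro closed_range_contraction.intro linear_contraction.intro
        closed_range_contraction_axioms.intro)
  show ?thesis
    using T_sv_single sv_inverse_id_minus
    by (simp add: fun_eq_iff[of "mp_inverse _"] mp_inverse_id_minus)
qed

end
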